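(* Let $f:\mathbb{R}\to\mathbb{R}$ and $g:\mathbb{R}\to\mathbb{R}$ be smooth functions, with $g$ monotonically increasing in the sense that $g'(\xi)>0$ for all $\xi\in\mathbb{R}$. For $a>0$ let $g_a(x)=g(x/a)$. Suppose there are functions $g_+$ and $g_-$, smooth up to the boundary $x=0$ on $[0,\infty)$ and $(-\infty,0]$ respectively, such that as $a\to0^+$, $g_a(x)\to g_0(x)$ pointwise for $x\neq 0$, where $$g_0(x)=\begin{cases} g_+(x), & x>0,\\ g_-(x), & x<0.\end{cases}$$ Write $g_0(x)=\lambda g_+(x)+(1-\lambda)g_-(x)$, where $\lambda=1$ for $x>0$ and $\lambda=0$ for $x<0$ (and, on $x=0$, the Filippov convention $\lambda\in[0,1]$ is used). Assume that $g_-(0)<f(0)<g_+(0)$. Then for all sufficiently small $a>0$ the system $$\dot x=g_a(x)-y,\qquad \dot y=f(x)-y$$ has a saddle equilibrium point $p_a=(x_a,y_a)$, and these can be chosen such that $x_a\to0$ as $a\to0^+$. When $a=0$, the nonsmooth system $$\dot x=g_0(x)-y,\qquad \dot y=f(x)-y$$ has a pseudoequilibrium on the splitting manifold $\{x=0\}$ that lies in a repelling sliding region and is stable for the sliding flow, and stable and unstable manifolds of this pseudoequilibrium exist locally (in the sense defined in the context).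
   Context: Saddle: an equilibrium of a smooth planar system at which the Jacobian has negative determinant (real eigenvalues of opposite sign). Nonsmooth system: the system with $a=0$ is a piecewise-smooth planar system with splitting manifold $\{x=0\}$ (defined by $h(x,y)=x=0$). It is written as the convex combination $\mathbf{f}(\mathbf{x},\lambda)=\lambda f^+(\mathbf{x})+(1-\lambda)f^-(\mathbf{x})$, where $f^+$ is the vector field in $x>0$ (obtained by replacing $g_0$ by $g_+$) and $f^-$ is the vector field in $x<0$ (obtained by replacing $g_0$ by $g_-$), with $\lambda=1$ for $x>0$, $\lambda=0$ for $x<0$, and $\lambda\in[0,1]$ on $x=0$. Both $f^\pm$ extend smoothly up to $x=0$. Sliding: let $S(\mathbf{x},\lambda)=\mathbf{f}(\mathbf{x},\lambda)\cdot\nabla h(\mathbf{x})$. The sliding region is the set of points of $\{x=0\}$ at which $S=0$ can be solved for some $\lambda\in[0,1]$. The sliding flow is the flow on the sliding region obtained by substituting this $\lambda$ into $\dot{\mathbf{x}}=\mathbf{f}(\mathbf{x},\lambda)$. The sliding region is attracting (stable) if $\frac{dS}{d\lambda}<0$ along it, and repelling (unstable) if $\frac{dS}{d\lambda}>0$ along it. Pseudoequilibrium: an equilibrium of the Filippov (sliding) flow on $\{x=0\}$, i.e. a point $p$ with $x=0$ at which $\lambda f^+(p)+(1-\lambda)f^-(p)=0$ for some $\lambda\in[0,1]$, although $f^\pm(p)\neq0$. Its stability refers to its stability as an equilibrium of the one-dimensional sliding flow (stable meaning asymptotically stable). Local stable and unstable manifolds (nonsmooth analogue in this case): a local stable manifold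 of the pseudoequilibrium $p$ is a relatively open interval of the sliding region in $\{x=0\}$ containing $p$, all of whose points tend to $p$ under the sliding flow as $t\to\infty$. A local unstable manifold consists of $p$ together with two trajectories emanating from $p$, one in $\{x<0\}$ (a solution of $f^-$) and one in $\{x>0\}$ (a solution of $f^+$), the one on each side being unique; each reaches $p$ in finite backward time. *)

theory Defs
  imports "HOL-Analysis.Analysis"
begin

section \<open>Smooth functions on intervals\<close>

text \<open>
  For a nondegenerate interval \<open>S\<close>: derivatives of all orders exist relative to \<open>S\<close>, hence
  one-sided ones at an endpoint belonging to \<open>S\<close>. So \<open>smooth_on UNIV\<close> is ordinary smoothness,
  and \<open>smooth_on {0..}\<close> is smoothness up to the boundary; values outside \<open>S\<close> are irrelevant.
\<close>
definition smooth_on :: "real set \<Rightarrow> (real \<Rightarrow> real) \<Rightarrow> bool" where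
  "smooth_on S f \<longleftrightarrow>
     (\<exists>D. D 0 = f \<and>
        (\<forall>n::nat. \<forall>x\<in>S. (D n has_real_derivative D (Suc n) x) (at x within S)))"


section \<open>Planar systems\<close>

text \<open>The right-hand side of \<open>x' = u(x) - y, y' = f(x) - y\<close>.\<close>
definition planar_field :: "(real \<Rightarrow> real) \<Rightarrow> (real \<Rightarrow> real) \<Rightarrow> real^2 \<Rightarrow> real^2" where
  "planar_field u f p = vector [u (p$1) - p$2, f (p$1) - p$2]"

definition saddle :: "(real^2 \<Rightarrow> real^2) \<Rightarrow> real^2 \<Rightarrow> bool" where
  "saddle X p \<longleftrightarrow> X differentiable (at p) \<and> X p = 0 \<and>
     det (jacobian X (at p)) < 0"


section \<open>Filippov systems with splitting manifold \<open>x = 0\<close>\<close>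

text \<open>
  Throughout, \<open>fp\<close> and \<open>fm\<close> are the vector fields in \<open>x > 0\<close> and \<open>x < 0\<close>; they are only ever
  evaluated on the corresponding closed half-planes.
\<close>

definition hsplit :: "real^2 \<Rightarrow> real" where
  "hsplit p = p$1"

definition splitting_manifold :: "(real^2) set" where
  "splitting_manifold = {p. hsplit p = 0}"

definition grad :: "(real^2 \<Rightarrow> real) \<Rightarrow> real^2 \<Rightarrow> real^2" where
  "grad h p = (\<chi> i. frechet_derivative h (at p) (axis i 1))"

definition filippov_field ::
    "(real^2 \<Rightarrow> real^2) \<Rightarrow> (real^2 \<Rightarrow> real^2) \<Rightarrow> real^2 \<Rightarrow> real \<Rightarrow> real^2" where
  "filippov_field fp fm p l = l *\<^sub>R fp p + (1 - l) *\<^sub>R fm p"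

lemma filippov_field_planar_field:
  "filippov_field (planar_field gp f) (planar_field gm f) p l =
     planar_field (\<lambda>x. l * gp x + (1 - l) * gm x) f p"
  by (simp add: filippov_field_def planar_field_def vec_eq_iff forall_2 algebra_simps)

lemma grad_hsplit: "grad hsplit p = axis 1 1"
proof -
  have "(hsplit has_derivative hsplit) (at p)"
    unfolding hsplit_def by (intro bounded_linear_imp_has_derivative bounded_linear_vec_nth)
  then have "frechet_derivative hsplit (at p) = hsplit"
    by (metis frechet_derivative_at)
  then show ?thesis
    by (simp add: grad_def hsplit_def axis_def vec_eq_iff)
qed

definition sliding_fun ::
    "(real^2 \<Rightarrow> real^2) \<Rightarrow> (real^2 \<Rightarrow> real^2) \<Rightarrow> real^2 \<Rightarrow> real \<Rightarrow> real" where
  "sliding_fun fp fm p l = filippov_field fp fm p l \<bullet> grad hsplit p"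

definition sliding_region ::
    "(real^2 \<Rightarrow> real^2) \<Rightarrow> (real^2 \<Rightarrow> real^2) \<Rightarrow> (real^2) set" where
  "sliding_region fp fm =
     {p \<in> splitting_manifold. \<exists>l\<in>{0..1}. sliding_fun fp fm p l = 0}"

definition repelling_sliding ::
    "(real^2 \<Rightarrow> real^2) \<Rightarrow> (real^2 \<Rightarrow> real^2) \<Rightarrow> bool" where
  "repelling_sliding fp fm \<longleftrightarrow>
     (\<forall>q\<in>sliding_region fp fm. \<forall>l\<in>{0..1}. sliding_fun fp fm q l = 0 \<longrightarrow>
        deriv (sliding_fun fp fm q) l > 0)"

text \<open>
  Where the sliding region is attracting or repelling, \<open>sliding_fun fp fm q\<close> is a nonconstant
  affine function, so that the \<open>l\<close> below is unique.
\<close>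
definition sliding_solution ::
    "(real^2 \<Rightarrow> real^2) \<Rightarrow> (real^2 \<Rightarrow> real^2) \<Rightarrow> real set \<Rightarrow> (real \<Rightarrow> real^2) \<Rightarrow> bool" where
  "sliding_solution fp fm I \<gamma> \<longleftrightarrow>
     (\<forall>t\<in>I. \<gamma> t \<in> splitting_manifold \<and>
        (\<exists>l\<in>{0..1}. sliding_fun fp fm (\<gamma> t) l = 0 \<and>
           (\<gamma> has_vector_derivative filippov_field fp fm (\<gamma> t) l) (at t within I)))"

definition pseudoequilibrium ::
    "(real^2 \<Rightarrow> real^2) \<Rightarrow> (real^2 \<Rightarrow> real^2) \<Rightarrow> real^2 \<Rightarrow> bool" where
  "pseudoequilibrium fp fm p \<longleftrightarrow>
     p \<in> splitting_manifold \<and> (\<exists>l\<in>{0..1}. filippov_field fp fm p l = 0) \<and>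
     fp p \<noteq> 0 \<and> fm p \<noteq> 0"

text \<open>The point \<open>q\<close> has a forward sliding orbit for all times, and this orbit tends to \<open>p\<close>.\<close>
definition sliding_tends_to ::
    "(real^2 \<Rightarrow> real^2) \<Rightarrow> (real^2 \<Rightarrow> real^2) \<Rightarrow> real^2 \<Rightarrow> real^2 \<Rightarrow> bool" where
  "sliding_tends_to fp fm q p \<longleftrightarrow>
     (\<exists>\<gamma>. sliding_solution fp fm {0..} \<gamma> \<and> \<gamma> 0 = q) \<and>
     (\<forall>\<gamma>. sliding_solution fp fm {0..} \<gamma> \<and> \<gamma> 0 = q \<longrightarrow> (\<gamma> \<longlongrightarrow> p) at_top)"

definition sliding_asymptotically_stable ::
    "(real^2 \<Rightarrow> real^2) \<Rightarrow> (real^2 \<Rightarrow> real^2) \<Rightarrow> real^2 \<Rightarrow> bool" where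
  "sliding_asymptotically_stable fp fm p \<longleftrightarrow>
     (\<forall>\<epsilon>>0. \<exists>\<delta>>0. \<forall>q\<in>sliding_region fp fm. dist q p < \<delta> \<longrightarrow>
        (\<forall>\<gamma> T. sliding_solution fp fm {0..T} \<gamma> \<and> \<gamma> 0 = q \<longrightarrow>
           (\<forall>t\<in>{0..T}. dist (\<gamma> t) p < \<epsilon>))) \<and>
     (\<exists>\<delta>>0. \<forall>q\<in>sliding_region fp fm. dist q p < \<delta> \<longrightarrow> sliding_tends_to fp fm q p)"

definition local_stable_manifold ::
    "(real^2 \<Rightarrow> real^2) \<Rightarrow> (real^2 \<Rightarrow> real^2) \<Rightarrow> real^2 \<Rightarrow> (real^2) set \<Rightarrow> bool" where
  "local_stable_manifold fp fm p W \<longleftrightarrow>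
     W \<subseteq> sliding_region fp fm \<and> openin (top_of_set splitting_manifold) W \<and>
     is_interval W \<and> p \<in> W \<and> (\<forall>q\<in>W. sliding_tends_to fp fm q p)"

text \<open>
  A solution \<open>\<eta>\<close> of \<open>X\<close> on the time interval \<open>(s, e)\<close>, running in \<open>H\<close>, that tends to \<open>p\<close> as
  \<open>t\<close> decreases to \<open>s\<close>. The case \<open>s = -\<infinity>\<close> (\<open>p\<close> reached only in infinite backward time) is included.
\<close>
definition emanates ::
    "(real^2 \<Rightarrow> real^2) \<Rightarrow> (real^2) set \<Rightarrow> real^2 \<Rightarrow> ereal \<Rightarrow> ereal \<Rightarrow> (real \<Rightarrow> real^2) \<Rightarrow> bool" where
  "emanates X H p s e \<eta> \<longleftrightarrow> s < e \<and>
     (\<forall>t\<in>einterval s e. \<eta> t \<in> H \<and> (\<eta> has_vector_derivative X (\<eta> t)) (at t)) \<and>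
     ((\<eta> \<circ> real_of_ereal) \<longlongrightarrow> p) (at_right s)"

text \<open>
  The trajectory \<open>\<gamma>\<close>, leaving \<open>p\<close> at time \<open>0\<close>, is the only one that emanates from \<open>p\<close> into \<open>H\<close>:
  every other one also leaves \<open>p\<close> at a finite time, and after a time shift it agrees with \<open>\<gamma>\<close> as
  long as both are defined.
\<close>
definition unique_emanating ::
    "(real^2 \<Rightarrow> real^2) \<Rightarrow> (real^2) set \<Rightarrow> real^2 \<Rightarrow> real \<Rightarrow> (real \<Rightarrow> real^2) \<Rightarrow> bool" where
  "unique_emanating X H p T \<gamma> \<longleftrightarrow> emanates X H p 0 (ereal T) \<gamma> \<and>
     (\<forall>s e \<eta>. emanates X H p s e \<eta> \<longrightarrow>
        (\<exists>s0. s = ereal s0 \<and> (\<forall>t. 0 < t \<and> t < T \<and> ereal (s0 + t) < e \<longrightarrow> \<eta> (s0 + t) = \<gamma> t)))"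

definition local_unstable_manifold ::
    "(real^2 \<Rightarrow> real^2) \<Rightarrow> (real^2 \<Rightarrow> real^2) \<Rightarrow> real^2 \<Rightarrow> (real^2) set \<Rightarrow> bool" where
  "local_unstable_manifold fp fm p W \<longleftrightarrow>
     (\<exists>Tm Tp \<gamma>m \<gamma>p.
        unique_emanating fm {q. hsplit q < 0} p Tm \<gamma>m \<and>
        unique_emanating fp {q. hsplit q > 0} p Tp \<gamma>p \<and>
        W = {p} \<union> \<gamma>m ` {0<..<Tm} \<union> \<gamma>p ` {0<..<Tp})"

end

theory Submission
  imports Defs
begin

text \<open>
  The smooth system is blown up by the scaling \<open>x = a \<xi>\<close>, which turns the equilibrium condition into
  \<open>g \<xi> = f (a \<xi>)\<close>. The limits of \<open>g (x / a)\<close> on the two sides of \<open>0\<close> show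
  that \<open>g\<close> takes values below and above \<open>f 0\<close>; the intermediate value theorem gives a
  root in a fixed interval \<open>[\<xi>1, \<xi>2]\<close> once \<open>a\<close> is small, whence \<open>x\<^sub>a = a \<xi> \<rightarrow> 0\<close>. The Jacobian
  determinant at such a point is \<open>f' (a \<xi>) - g' \<xi> / a\<close>; on the compact interval \<open>g'\<close> has a positive
  lower bound while \<open>f' (a \<xi>)\<close> stays bounded, so the determinant is negative for small \<open>a\<close>
  (\<open>saddle_family\<close>).
  
  For the nonsmooth system the pseudoequilibrium is \<open>p = (0, f 0)\<close>. On \<open>x = 0\<close> the sliding condition fixes
  the convex combination of \<open>gp 0\<close> and \<open>gm 0\<close> to be \<open>y\<close>: the sliding region is the segment
  \<open>gm 0 \<le> y \<le> gp 0\<close>, it is repelling because \<open>gp 0 - gm 0 > 0\<close>, and the sliding flow on it is the linear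
  equation \<open>y' = f 0 - y\<close>, which contracts exponentially to \<open>p\<close>. This yields stability, and the open
  segment is a local stable manifold.
  
  For the unstable manifold, the first components of the two fields at \<open>p\<close> are \<open>gp 0 - f 0 > 0\<close> and
  \<open>gm 0 - f 0 < 0\<close>, so both fields leave \<open>x = 0\<close> transversally. A locally Lipschitz field on a closed
  half-space that points strictly inwards at a boundary point sends exactly one trajectory from that
  point into the interior (\<open>transversal_departure\<close>): existence comes from Picard iteration
  (\<open>picard_lipschitz\<close>), uniqueness from a Gronwall estimate (\<open>lipschitz_solutions_eq\<close>), and the strictly
  positive normal speed excludes trajectories that reach the point only in infinite backward time.
\<close>


section \<open>Solutions of Lipschitz differential equations\<close>

text \<open>
  The Picard operator contracts bounded continuous curves as soon as \<open>L * T \<le> 1/2\<close>. It is set up on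
  curves defined for all real times, where bounded continuous functions form a complete space, by
  freezing the time argument outside \<open>[0, T]\<close>.
\<close>
lemma picard_lipschitz:
  fixes X :: "'a::banach \<Rightarrow> 'a"
  assumes L: "L-lipschitz_on UNIV X"
  shows "\<exists>T>0. \<exists>u. u 0 = p \<and> (\<forall>t\<in>{0..T}. (u has_vector_derivative X (u t)) (at t within {0..T}))"
proof -
  have L0: "0 \<le> L" using L by (rule lipschitz_on_nonneg)
  define T where "T = 1 / (2 * (L + 1))"
  have T0: "0 < T" and LT: "L * T \<le> 1/2"
    using L0 by (auto simp: T_def field_simps)
  define c where "c t = max 0 (min t T)" for t
  have c: "c t \<in> {0..T}" for t using T0 by (auto simp: c_def)
  have cont_c: "continuous_on UNIV c" unfolding c_def by (intro continuous_intros)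
  have cont_X: "continuous_on UNIV X" using L by (rule lipschitz_on_continuous_on)
  have cont_Xu: "continuous_on S (\<lambda>s. X (apply_bcontfun u s))" for u and S :: "real set"
    by (rule continuous_on_compose2[OF cont_X continuous_on_apply_bcontfun]) auto
  define F where "F u t = p + integral {0..c t} (\<lambda>s. X (apply_bcontfun u s))" for u t
  have int: "(\<lambda>s. X (apply_bcontfun u s)) integrable_on {0..b}" for u and b :: real
    by (rule integrable_continuous_real[OF cont_Xu])
  have F: "F u \<in> bcontfun" for u
  proof -
    have 1: "continuous_on {0..T} (\<lambda>t. p + integral {0..t} (\<lambda>s. X (apply_bcontfun u s)))" (is "continuous_on _ ?G")
      by (intro continuous_intros indefinite_integral_continuous_1 int)
    have eq: "F u = ?G \<circ> c" by (auto simp: F_def)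
    have "continuous_on UNIV (F u)" unfolding eq
      by (rule continuous_on_compose[OF cont_c]) (rule continuous_on_subset[OF 1], use c in auto)
    moreover have "bounded (?G ` {0..T})"
      by (intro compact_imp_bounded compact_continuous_image 1) simp
    then have "bounded (range (F u))"
      by (rule bounded_subset) (use c in \<open>auto simp: F_def\<close>)
    ultimately show ?thesis by (simp add: bcontfun_def)
  qed
  have contr: "dist (Bcontfun (F u)) (Bcontfun (F v)) \<le> 1/2 * dist u v" for u v
  proof (rule dist_bound)
    fix t
    have "dist (F u t) (F v t) = norm (integral {0..c t} (\<lambda>s. X (apply_bcontfun u s) - X (apply_bcontfun v s)))"
      by (simp add: F_def dist_norm integral_diff[OF int int])
    also have "\<dots> \<le> L * dist u v * (c t - 0)"
    proof (rule integral_bound)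
      show "norm (X (apply_bcontfun u s) - X (apply_bcontfun v s)) \<le> L * dist u v" for s
        using lipschitz_onD[OF L, of "apply_bcontfun u s" "apply_bcontfun v s"]
          mult_left_mono[OF dist_bounded[of u s v] L0] by (simp add: dist_norm)
    qed (use c[of t] in \<open>auto intro!: continuous_intros cont_Xu\<close>)
    also have "\<dots> \<le> L * dist u v * T"
      using c[of t] L0 by (intro mult_left_mono) auto
    also have "\<dots> \<le> 1/2 * dist u v"
      using mult_right_mono[OF LT, of "dist u v"] by (simp add: mult_ac)
    finally show "dist (apply_bcontfun (Bcontfun (F u)) t) (apply_bcontfun (Bcontfun (F v)) t) \<le> 1/2 * dist u v"
      by (simp add: Bcontfun_inverse F)
  qed
  have "\<exists>!u. Bcontfun (F u) = u"
    by (rule banach_fix_type[of "1/2"]) (use contr in auto)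
  then obtain w where w: "Bcontfun (F w) = w" by blast
  define u where "u = apply_bcontfun w"
  have u: "u t = F w t" for t
    unfolding u_def using w F[of w] by (metis Bcontfun_inverse)
  have u_eq: "u t = p + integral {0..t} (\<lambda>s. X (u s))" if "t \<in> {0..T}" for t
    unfolding u[of t] using that by (simp add: F_def c_def u_def)
  have "(u has_vector_derivative X (u t)) (at t within {0..T})" if t: "t \<in> {0..T}" for t
  proof -
    have "((\<lambda>t. p + integral {0..t} (\<lambda>s. X (u s))) has_vector_derivative 0 + X (u t)) (at t within {0..T})"
      by (intro has_vector_derivative_add has_vector_derivative_const integral_has_vector_derivative t)
        (simp add: u_def cont_Xu)
    then have "((\<lambda>t. p + integral {0..t} (\<lambda>s. X (u s))) has_vector_derivative X (u t)) (at t within {0..T})"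
      by simp
    then show ?thesis
      by (rule has_vector_derivative_transform[OF t, rotated])
        (simp add: u_eq)
  qed
  moreover have "u 0 = p" using T0 u_eq[of 0] by simp
  ultimately show ?thesis using T0 by blast
qed

text \<open>
  Gronwall's argument: \<open>\<parallel>u - v\<parallel>\<^sup>2 * exp (- 2 L t)\<close> is nonincreasing and vanishes at the left endpoint.
  The equations are required in the open interval only, to cover a trajectory that has merely a limit at
  its starting time.
\<close>
lemma lipschitz_solutions_eq:
  fixes X :: "'a::real_inner \<Rightarrow> 'a"
  assumes L: "L-lipschitz_on K X"
    and u: "continuous_on {a..b} u" "\<And>t. a < t \<Longrightarrow> t < b \<Longrightarrow> u t \<in> K \<and> (u has_vector_derivative X (u t)) (at t)"
    and v: "continuous_on {a..b} v" "\<And>t. a < t \<Longrightarrow> t < b \<Longrightarrow> v t \<in> K \<and> (v has_vector_derivative X (v t)) (at t)"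
    and eq: "u a = v a" and ab: "a \<le> b"
  shows "u b = v b"
proof -
  define w where "w t = u t - v t" for t
  define W where "W t = (w t \<bullet> w t) * exp (- 2 * L * t)" for t
  have "W b \<le> W a"
  proof (rule DERIV_nonpos_imp_decreasing_open[OF ab])
    fix t assume t: "a < t" "t < b"
    let ?d = "X (u t) - X (v t)"
    have "(w has_vector_derivative ?d) (at t)"
      unfolding w_def using u(2)[OF t] v(2)[OF t] by (auto intro: has_vector_derivative_diff)
    then have w': "(w has_derivative (\<lambda>h. h *\<^sub>R ?d)) (at t)"
      by (simp add: has_vector_derivative_def)
    have "((\<lambda>t. w t \<bullet> w t) has_derivative (\<lambda>h. w t \<bullet> h *\<^sub>R ?d + h *\<^sub>R ?d \<bullet> w t)) (at t)"
      by (rule has_derivative_inner[OF w' w'])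
    then have 1: "((\<lambda>t. w t \<bullet> w t) has_real_derivative 2 * (w t \<bullet> ?d)) (at t)"
      unfolding has_field_derivative_def
      by (rule has_derivative_eq_rhs) (auto simp: inner_commute algebra_simps)
    have "(W has_real_derivative (2 * (w t \<bullet> ?d) - 2 * L * (w t \<bullet> w t)) * exp (- 2 * L * t)) (at t)"
      unfolding W_def by (rule derivative_eq_intros 1 refl)+ (simp add: algebra_simps)
    moreover have "w t \<bullet> ?d \<le> L * (w t \<bullet> w t)"
    proof -
      have "norm ?d \<le> L * norm (w t)"
        using lipschitz_onD[OF L, of "u t" "v t"] u(2)[OF t] v(2)[OF t] by (simp add: dist_norm w_def)
      have "w t \<bullet> ?d \<le> norm (w t) * norm ?d" by (rule norm_cauchy_schwarz)
      also have "\<dots> \<le> norm (w t) * (L * norm (w t))"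
        by (intro mult_left_mono) (use \<open>norm ?d \<le> _\<close> in auto)
      finally show ?thesis by (simp add: dot_square_norm power2_eq_square algebra_simps)
    qed
    ultimately show "\<exists>y. (W has_real_derivative y) (at t) \<and> y \<le> 0"
      by (intro exI conjI) (auto intro!: mult_nonpos_nonneg)
  qed (auto simp: W_def w_def intro!: continuous_intros u v)
  then have "w b \<bullet> w b * exp (- 2 * L * b) \<le> 0"
    by (simp add: W_def w_def eq)
  then have "w b \<bullet> w b \<le> 0" by (simp add: mult_le_0_iff)
  then have "w b \<bullet> w b = 0" using inner_ge_zero[of "w b"] by linarith
  then have "w b = 0" by simp
  then show ?thesis by (simp add: w_def)
qed


section \<open>Trajectories leaving the boundary of a half-space\<close>

text \<open>
  A field given on a closed half-space only is extended to the whole space, without enlarging its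
  Lipschitz constant, by composing it with the nearest-point projection onto a convex set. As the normal
  speed at \<open>p\<close> is positive, the solution of the extended field starting at \<open>p\<close> immediately enters the open
  half-space, where the two fields agree.
\<close>
lemma transversal_departure:
  fixes X :: "real^2 \<Rightarrow> real^2"
  assumes lip: "\<And>R. \<exists>L. L-lipschitz_on (cball p R \<inter> {q. 0 \<le> n \<bullet> (q - p)}) X"
    and pos: "0 < n \<bullet> X p"
  shows "\<exists>T \<gamma>. unique_emanating X {q. 0 < n \<bullet> (q - p)} p T \<gamma>"
proof -
  define c where "c = n \<bullet> X p"
  define K where "K R = cball p R \<inter> {q. 0 \<le> n \<bullet> (q - p)}" for R
  have "closed {q. 0 \<le> n \<bullet> (q - p)}"
    by (intro closed_Collect_le continuous_intros)
  moreover have "{q. 0 \<le> n \<bullet> (q - p)} = {q. n \<bullet> q \<ge> n \<bullet> p}" by (auto simp: inner_diff_right)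
  then have "convex {q. 0 \<le> n \<bullet> (q - p)}" by (simp add: convex_halfspace_ge)
  ultimately have K1: "closed (K 1)" "convex (K 1)" "p \<in> K 1"
    by (auto simp: K_def intro: convex_Int)
  obtain L1 where L1: "L1-lipschitz_on (K 1) X" using lip unfolding K_def by blast
  define Y where "Y q = X (closest_point (K 1) q)" for q
  have "L1-lipschitz_on UNIV Y"
  proof (rule lipschitz_onI)
    fix x y
    have "closest_point (K 1) z \<in> K 1" for z
      using closest_point_in_set[of "K 1" z] K1 by blast
    then have "dist (Y x) (Y y) \<le> L1 * dist (closest_point (K 1) x) (closest_point (K 1) y)"
      unfolding Y_def by (intro lipschitz_onD[OF L1])
    also have "\<dots> \<le> L1 * dist x y"
      using K1 by (intro mult_left_mono closest_point_lipschitz lipschitz_on_nonneg[OF L1]) auto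
    finally show "dist (Y x) (Y y) \<le> L1 * dist x y" .
  qed (rule lipschitz_on_nonneg[OF L1])
  then obtain T0 u where T0: "0 < T0" and u0: "u 0 = p"
    and u: "\<And>t. t \<in> {0..T0} \<Longrightarrow> (u has_vector_derivative Y (u t)) (at t within {0..T0})"
    using picard_lipschitz[of L1 Y p] by blast
  have Y: "Y q = X q" if "q \<in> K 1" for q
    using that by (simp add: Y_def closest_point_self)
  have "((\<lambda>t. n \<bullet> (u t - p)) has_real_derivative c) (at 0 within {0..T0})"
  proof -
    have "(u has_derivative (\<lambda>h. h *\<^sub>R X p)) (at 0 within {0..T0})"
      using u[of 0] T0 Y[of p] K1 u0 by (simp add: has_vector_derivative_def)
    then have "((\<lambda>t. n \<bullet> (u t - p)) has_derivative (\<lambda>h. n \<bullet> (h *\<^sub>R X p - 0))) (at 0 within {0..T0})"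
      by (intro has_derivative_inner_right has_derivative_diff has_derivative_const)
    then show ?thesis
      unfolding has_field_derivative_def by (rule has_derivative_eq_rhs) (auto simp: c_def)
  qed
  from has_real_derivative_pos_inc_right[OF this] pos
  obtain d1 where d1: "0 < d1" "\<And>h. 0 < h \<Longrightarrow> h \<le> T0 \<Longrightarrow> h < d1 \<Longrightarrow> 0 < n \<bullet> (u h - p)"
    by (auto simp: c_def u0)
  have cont_u: "continuous_on {0..T0} u"
    using u by (rule continuous_on_vector_derivative)
  then have lim_u: "(u \<longlongrightarrow> p) (at_right 0)"
    using T0 u0 by (auto simp: continuous_on_def at_within_Icc_at_right dest: bspec[of _ _ 0])
  obtain d2 where d2: "0 < d2" "\<And>t. t \<in> {0..T0} \<Longrightarrow> t < d2 \<Longrightarrow> dist (u t) p < 1"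
    using cont_u[unfolded continuous_on_iff, rule_format, of 0 1] T0 u0
    by (auto simp: dist_real_def)
  define T where "T = min T0 (min d1 d2)"
  have T: "0 < T" "T \<le> T0" using T0 d1 d2 by (auto simp: T_def)
  have uT: "0 < n \<bullet> (u t - p)" "(u has_vector_derivative X (u t)) (at t)" if "0 < t" "t < T" for t
  proof -
    show 1: "0 < n \<bullet> (u t - p)" using that by (intro d1) (auto simp: T_def)
    have "u t \<in> K 1"
      using d2(2)[of t] that 1 by (auto simp: K_def T_def dist_commute)
    then show "(u has_vector_derivative X (u t)) (at t)"
      using u[of t] that T by (simp add: Y at_within_Icc_at)
  qed
  have "unique_emanating X {q. 0 < n \<bullet> (q - p)} p T u"
    unfolding unique_emanating_def
  proof (intro conjI allI impI)
    show "emanates X {q. 0 < n \<bullet> (q - p)} p 0 (ereal T) u"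
      unfolding emanates_def using T uT lim_u
      by (auto simp: einterval_iff zero_ereal_def ereal_tendsto_simps1)
  next
    fix s e \<eta> assume em: "emanates X {q. 0 < n \<bullet> (q - p)} p s e \<eta>"
    then have se: "s < e" and lim: "((\<eta> \<circ> real_of_ereal) \<longlongrightarrow> p) (at_right s)"
      and \<eta>: "\<And>t. s < ereal t \<Longrightarrow> ereal t < e \<Longrightarrow>
            0 < n \<bullet> (\<eta> t - p) \<and> (\<eta> has_vector_derivative X (\<eta> t)) (at t)"
      by (auto simp: emanates_def einterval_iff)
    show "\<exists>s0. s = ereal s0 \<and> (\<forall>t. 0 < t \<and> t < T \<and> ereal (s0 + t) < e \<longrightarrow> \<eta> (s0 + t) = u t)"
    proof (cases s)
      case PInf
      then show ?thesis using se by simp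
    next
      case MInf
      \<comment> \<open>Near \<open>p\<close> the normal speed is at least \<open>c / 2\<close>, so following \<open>\<eta>\<close> backwards the distance to the
        boundary would become negative after finite time.\<close>
      have "continuous_on (K 1) (\<lambda>q. n \<bullet> X q)"
        by (intro continuous_intros lipschitz_on_continuous_on[OF L1])
      then obtain \<delta> where \<delta>: "0 < \<delta>" "\<And>q. q \<in> K 1 \<Longrightarrow> dist q p < \<delta> \<Longrightarrow> dist (n \<bullet> X q) c < c / 2"
        using K1(3) pos unfolding continuous_on_iff c_def by (metis half_gt_zero)
      obtain r where r: "ereal r < e" using se MInf by (metis ereal_dense2 less_ereal.simps(2))
      have "(\<eta> \<longlongrightarrow> p) at_bot" using lim by (simp add: MInf ereal_tendsto_simps1)
      then have "\<forall>\<^sub>F t in at_bot. dist (\<eta> t) p < min \<delta> 1"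
        using \<delta>(1) by (intro tendstoD) auto
      then obtain N0 where N0: "\<And>t. t \<le> N0 \<Longrightarrow> dist (\<eta> t) p < min \<delta> 1"
        by (auto simp: eventually_at_bot_linorder)
      define N where "N = min N0 r"
      have e: "ereal t < e" if "t \<le> N" for t
        using that r by (metis N_def ereal_less_eq(3) min.boundedE order.strict_trans1)
      define \<phi> where "\<phi> t = n \<bullet> (\<eta> t - p)" for t
      have \<phi>pos: "0 < \<phi> t" if "t \<le> N" for t
        using \<eta>[of t] e[OF that] MInf by (simp add: \<phi>_def)
      define t where "t = N - 2 * \<phi> N / c"
      have tN: "t \<le> N" using \<phi>pos[of N] pos by (simp add: t_def c_def)
      have "\<phi> t - c / 2 * t \<le> \<phi> N - c / 2 * N"
      proof (rule DERIV_nonneg_imp_nondecreasing[OF tN])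
        fix x assume x: "t \<le> x" "x \<le> N"
        have \<eta>x: "0 < n \<bullet> (\<eta> x - p)" "(\<eta> has_derivative (\<lambda>h. h *\<^sub>R X (\<eta> x))) (at x)"
          using \<eta>[of x] e[OF x(2)] MInf by (auto simp: has_vector_derivative_def)
        have "(\<phi> has_derivative (\<lambda>h. n \<bullet> (h *\<^sub>R X (\<eta> x) - 0))) (at x)"
          unfolding \<phi>_def
          by (intro has_derivative_inner_right has_derivative_diff has_derivative_const \<eta>x)
        then have "(\<phi> has_real_derivative n \<bullet> X (\<eta> x)) (at x)"
          unfolding has_field_derivative_def by (rule has_derivative_eq_rhs) auto
        then have "((\<lambda>t. \<phi> t - c / 2 * t) has_real_derivative n \<bullet> X (\<eta> x) - c / 2) (at x)"
          by (auto intro!: derivative_eq_intros)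
        moreover have "\<eta> x \<in> K 1" "dist (\<eta> x) p < \<delta>"
          using \<eta>x N0[of x] x by (auto simp: K_def N_def dist_commute)
        then have "n \<bullet> X (\<eta> x) - c / 2 \<ge> 0"
          using \<delta>(2) by (fastforce simp: dist_real_def abs_if split: if_splits)
        ultimately show "\<exists>y. ((\<lambda>t. \<phi> t - c / 2 * t) has_real_derivative y) (at x) \<and> 0 \<le> y" by blast
      qed
      moreover have "c / 2 * t = c / 2 * N - \<phi> N"
        using pos by (simp add: t_def c_def field_simps)
      ultimately have "\<phi> t \<le> 0" by linarith
      then show ?thesis using \<phi>pos[OF tN] by simp
    next
      case (real s0)
      have "\<eta> (s0 + t) = u t" if t: "0 < t" "t < T" "ereal (s0 + t) < e" for t
      proof -
        \<comment> \<open>\<open>\<eta>\<close> shifted in time, and completed at its starting time by its limit \<open>p\<close>\<close>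
        define v where "v r = (if r \<le> 0 then p else \<eta> (r + s0))" for r
        have \<eta>r: "0 < n \<bullet> (\<eta> (r + s0) - p)" "(v has_vector_derivative X (v r)) (at r)"
          if r: "0 < r" "r \<le> t" for r
        proof -
          have "ereal (r + s0) < e" using r t by (metis add.commute add_left_mono ereal_less_eq(3) order.strict_trans1)
          then have *: "0 < n \<bullet> (\<eta> (r + s0) - p)" "(\<eta> has_vector_derivative X (\<eta> (r + s0))) (at (r + s0))"
            using \<eta>[of "r + s0"] r real by auto
          show "0 < n \<bullet> (\<eta> (r + s0) - p)" by fact
          have "((\<lambda>r. r + s0) has_vector_derivative 1) (at r)"
            by (auto intro!: derivative_eq_intros)
          from vector_diff_chain_at[OF this, of \<eta>] *(2)
          have "((\<lambda>r. \<eta> (r + s0)) has_vector_derivative X (v r)) (at r)"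
            using r by (simp add: o_def v_def)
          then show "(v has_vector_derivative X (v r)) (at r)"
            by (rule has_vector_derivative_transform_within_open[of _ _ _ "{0<..}"])
              (use r in \<open>auto simp: v_def\<close>)
        qed
        have "((\<lambda>r. \<eta> (r + s0)) \<longlongrightarrow> p) (at_right 0)"
          using lim by (simp add: real ereal_tendsto_simps1 filterlim_at_right_to_0[of _ _ s0])
        moreover have "\<forall>\<^sub>F r in at_right 0. \<eta> (r + s0) = v r"
          by (auto simp: v_def eventually_at_right_less intro: eventually_mono[OF eventually_at_right_less[of 0]])
        ultimately have "(v \<longlongrightarrow> p) (at_right 0)"
          by (rule Lim_transform_eventually)
        moreover have "v \<midarrow>r\<rightarrow> v r" if "0 < r" "r \<le> t" for r
          using has_vector_derivative_continuous[OF \<eta>r(2)[OF that]] by (simp add: isCont_def)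
        ultimately have cont_v: "continuous_on {0..t} v"
          using t by (intro continuous_on_IccI) (auto simp: v_def[of 0] intro: tendsto_within_subset)
        have cont_u': "continuous_on {0..t} u"
          by (rule continuous_on_subset[OF cont_u]) (use t T in auto)
        \<comment> \<open>Both curves stay in one ball up to time \<open>t\<close>, which provides a common Lipschitz constant.\<close>
        have "bounded (v ` {0..t} \<union> u ` {0..t})"
          by (intro bounded_Un[THEN iffD2] conjI compact_imp_bounded compact_continuous_image cont_v cont_u') auto
        then obtain R where R: "v ` {0..t} \<union> u ` {0..t} \<subseteq> cball p R"
          using bounded_subset_ballD ball_subset_cball by (metis subset_trans)
        obtain L where L: "L-lipschitz_on (K R) X" using lip unfolding K_def by blast
        have "v t = u t"
        proof (rule lipschitz_solutions_eq[OF L cont_v _ cont_u'])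
          fix r assume r: "0 < r" "r < t"
          have "v r \<in> cball p R" using r R by (auto simp: image_subset_iff)
          then show "v r \<in> K R \<and> (v has_vector_derivative X (v r)) (at r)"
            using \<eta>r[of r] r by (auto simp: K_def v_def[of r])
          show "u r \<in> K R \<and> (u has_vector_derivative X (u r)) (at r)"
            using uT[of r] r t R by (auto simp: K_def image_subset_iff)
        qed (use t in \<open>auto simp: v_def u0\<close>)
        then show ?thesis using t by (simp add: v_def add.commute)
      qed
      then show ?thesis using real by auto
    qed
  qed
  then show ?thesis by blast
qed


section \<open>Smooth functions and the planar field\<close>

lemma smooth_on_C1:
  assumes "smooth_on S f"
  obtains f' where "\<And>x. x \<in> S \<Longrightarrow> (f has_real_derivative f' x) (at x within S)" "continuous_on S f'"
proof -
  obtain D where D: "D 0 = f" "\<And>n x. x \<in> S \<Longrightarrow> (D n has_real_derivative D (Suc n) x) (at x within S)"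
    using assms by (auto simp: smooth_on_def)
  show ?thesis
  proof
    show "(f has_real_derivative D 1 x) (at x within S)" if "x \<in> S" for x
      using D(2)[OF that, of 0] by (simp add: D(1))
    show "continuous_on S (D 1)" using D(2) by (rule DERIV_continuous_on)
  qed
qed

lemma smooth_on_subset:
  assumes "smooth_on S f" "T \<subseteq> S"
  shows "smooth_on T f"
proof -
  obtain D where D: "D 0 = f" "\<And>n x. x \<in> S \<Longrightarrow> (D n has_real_derivative D (Suc n) x) (at x within S)"
    using assms(1) by (auto simp: smooth_on_def)
  have "(D n has_real_derivative D (Suc n) x) (at x within T)" if "x \<in> T" for n x
    using D(2)[of x n] that assms(2) by (auto intro: DERIV_subset)
  with D(1) show ?thesis unfolding smooth_on_def by blast
qed

lemma smooth_on_imp_continuous_on: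
  assumes "smooth_on S f"
  shows "continuous_on S f"
proof -
  obtain f' where "\<And>x. x \<in> S \<Longrightarrow> (f has_real_derivative f' x) (at x within S)"
    using smooth_on_C1[OF assms] by metis
  then show ?thesis by (rule DERIV_continuous_on)
qed

lemma smooth_on_imp_lipschitz:
  assumes "smooth_on S f" "C \<subseteq> S" "convex C" "compact C"
  obtains L where "L-lipschitz_on C f"
proof -
  obtain f' where f': "\<And>x. x \<in> S \<Longrightarrow> (f has_real_derivative f' x) (at x within S)" "continuous_on S f'"
    using smooth_on_C1[OF assms(1)] by blast
  have "compact (f' ` C)"
    using assms f'(2) by (meson compact_continuous_image continuous_on_subset)
  then obtain B where B: "0 < B" "\<And>x. x \<in> C \<Longrightarrow> norm (f' x) \<le> B"
    by (metis bounded_pos compact_imp_bounded imageI)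
  have "B-lipschitz_on C f"
  proof (rule lipschitz_onI)
    fix x y assume "x \<in> C" "y \<in> C"
    then show "dist (f x) (f y) \<le> B * dist x y"
      unfolding dist_norm
      by (intro field_differentiable_bound[OF assms(3), of f f']) (use f'(1) assms(2) B in \<open>auto intro: DERIV_subset\<close>)
  qed (use B in auto)
  then show ?thesis ..
qed

lemma planar_field_components [simp]:
  "planar_field u f q $ 1 = u (q$1) - q$2" "planar_field u f q $ 2 = f (q$1) - q$2"
  by (simp_all add: planar_field_def)

lemma planar_field_lipschitz:
  assumes "smooth_on S u" "smooth_on S f" "closed S" "convex S"
  shows "\<exists>L. L-lipschitz_on (cball p R \<inter> {q. q$1 \<in> S}) (planar_field u f)"
proof -
  define C where "C = S \<inter> cball (p$1) R"
  have C: "C \<subseteq> S" "convex C" "compact C"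
    using assms by (auto simp: C_def convex_Int closed_Int_compact)
  obtain Lu where Lu: "Lu-lipschitz_on C u" using smooth_on_imp_lipschitz[OF assms(1) C] .
  obtain Lf where Lf: "Lf-lipschitz_on C f" using smooth_on_imp_lipschitz[OF assms(2) C] .
  note nn = lipschitz_on_nonneg[OF Lu] lipschitz_on_nonneg[OF Lf]
  have "(Lu + Lf + 2)-lipschitz_on (cball p R \<inter> {q. q$1 \<in> S}) (planar_field u f)"
  proof (rule lipschitz_onI)
    fix x y assume xy: "x \<in> cball p R \<inter> {q. q$1 \<in> S}" "y \<in> cball p R \<inter> {q. q$1 \<in> S}"
    then have "x$1 \<in> C" "y$1 \<in> C"
      using dist_vec_nth_le[of p 1 x] dist_vec_nth_le[of p 1 y] by (auto simp: C_def)
    then have "\<bar>u (x$1) - u (y$1)\<bar> \<le> Lu * \<bar>x$1 - y$1\<bar>" "\<bar>f (x$1) - f (y$1)\<bar> \<le> Lf * \<bar>x$1 - y$1\<bar>"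
      using lipschitz_onD[OF Lu, of "x$1" "y$1"] lipschitz_onD[OF Lf, of "x$1" "y$1"]
      by (auto simp: dist_real_def)
    moreover have 1: "\<bar>x$1 - y$1\<bar> \<le> dist x y" "\<bar>x$2 - y$2\<bar> \<le> dist x y"
      using dist_vec_nth_le[of x 1 y] dist_vec_nth_le[of x 2 y] by (auto simp: dist_real_def)
    moreover note mult_left_mono[OF 1(1) nn(1)] mult_left_mono[OF 1(1) nn(2)]
    moreover have "dist (planar_field u f x) (planar_field u f y)
        \<le> \<bar>(u (x$1) - x$2) - (u (y$1) - y$2)\<bar> + \<bar>(f (x$1) - x$2) - (f (y$1) - y$2)\<bar>"
      using norm_le_l1_cart[of "planar_field u f x - planar_field u f y"]
      by (simp add: dist_norm sum_2)
    ultimately have "dist (planar_field u f x) (planar_field u f y)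
        \<le> Lu * dist x y + Lf * dist x y + 2 * dist x y"
      by linarith
    then show "dist (planar_field u f x) (planar_field u f y) \<le> (Lu + Lf + 2) * dist x y"
      by (simp add: distrib_right)
  qed (use nn in auto)
  then show ?thesis ..
qed


section \<open>Saddles of the smooth system\<close>

lemma has_derivative_planar_field:
  assumes "(u has_real_derivative u') (at x)" "(f has_real_derivative f') (at x)"
  shows "(planar_field u f has_derivative
     (\<lambda>h. vector [u' * h$1 - h$2, f' * h$1 - h$2])) (at (vector [x, y]))"
proof -
  have 1: "((\<lambda>q :: real^2. w (q$1) - q$2) has_derivative (\<lambda>h. w' * h$1 - h$2)) (at (vector [x, y]))"
    if "(w has_real_derivative w') (at x)" for w w'
  proof -
    have "((\<lambda>q :: real^2. w (q$1)) has_derivative (\<lambda>h. w' * h$1)) (at (vector [x, y]))"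
      using that by (intro has_derivative_compose[of "\<lambda>q. q$1" "\<lambda>h. h$1" _ _ w "(*) w'", simplified])
        (auto simp: has_field_derivative_def intro!: bounded_linear_imp_has_derivative bounded_linear_vec_nth)
    then show ?thesis
      by (intro has_derivative_diff bounded_linear_imp_has_derivative bounded_linear_vec_nth)
  qed
  have "\<forall>i. ((\<lambda>q. planar_field u f q $ i) has_derivative
      (\<lambda>h. (vector [u' * h$1 - h$2, f' * h$1 - h$2] :: real^2) $ i)) (at (vector [x, y]))"
    unfolding forall_2 using assms[THEN 1] by simp
  then show ?thesis
    by (subst has_derivative_componentwise_within) (auto simp: Basis_vec_def inner_axis)
qed

lemma saddle_planar_field:
  assumes "(u has_real_derivative u') (at x)" "(f has_real_derivative f') (at x)"
    and "u x = f x" "f' < u'"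
  shows "saddle (planar_field u f) (vector [x, f x])"
proof -
  note der = has_derivative_planar_field[OF assms(1,2), of "f x"]
  have "jacobian (planar_field u f) (at (vector [x, f x])) = matrix (\<lambda>h. vector [u' * h$1 - h$2, f' * h$1 - h$2])"
    unfolding jacobian_def using frechet_derivative_at[OF der] by simp
  then have "det (jacobian (planar_field u f) (at (vector [x, f x]))) = f' - u'"
    by (simp add: det_2 matrix_def axis_def)
  moreover have "planar_field u f (vector [x, f x]) = 0"
    using assms(3) by (simp add: vec_eq_iff forall_2)
  ultimately show ?thesis
    using der assms(4) by (auto simp: saddle_def differentiable_def)
qed

text \<open>
  The bracket \<open>[\<xi>1, \<xi>2]\<close> does not depend on \<open>a\<close>: this is what gives \<open>a \<xi> \<rightarrow> 0\<close> and, by compactness, a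
  lower bound for \<open>g'\<close> that eventually beats \<open>a * f'\<close>.
\<close>
lemma saddle_family:
  assumes "smooth_on UNIV f" "smooth_on UNIV g" and pos: "\<And>\<xi>. deriv g \<xi> > 0"
    and le: "\<xi>1 \<le> \<xi>2" and g1: "g \<xi>1 < f 0" and g2: "f 0 < g \<xi>2"
  shows "\<forall>\<^sub>F a in at_right 0. \<exists>\<xi>\<in>{\<xi>1..\<xi>2}.
     saddle (planar_field (\<lambda>x. g (x / a)) f) (vector [a * \<xi>, f (a * \<xi>)])"
proof -
  obtain f' where f': "\<And>x. (f has_real_derivative f' x) (at x)" "continuous_on UNIV f'"
    using smooth_on_C1[OF assms(1)] by auto
  obtain g' where g': "\<And>x. (g has_real_derivative g' x) (at x)" "continuous_on UNIV g'"
    using smooth_on_C1[OF assms(2)] by auto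
  have g'pos: "0 < g' x" for x using pos[of x] DERIV_imp_deriv[OF g'(1)[of x]] by simp
  have "\<exists>\<xi>\<in>{\<xi>1..\<xi>2}. \<forall>x\<in>{\<xi>1..\<xi>2}. g' \<xi> \<le> g' x"
    by (rule continuous_attains_inf) (use le g'(2) in \<open>auto intro: continuous_on_subset\<close>)
  then obtain m where m: "0 < m" "\<And>x. x \<in> {\<xi>1..\<xi>2} \<Longrightarrow> m \<le> g' x" using g'pos by blast
  define M where "M = max \<bar>\<xi>1\<bar> \<bar>\<xi>2\<bar>"
  have "compact (f' ` {-M..M})"
    by (intro compact_continuous_image continuous_on_subset[OF f'(2)]) auto
  then obtain B where B: "0 < B" "\<And>x. x \<in> {-M..M} \<Longrightarrow> \<bar>f' x\<bar> \<le> B"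
    unfolding real_norm_def[symmetric] by (metis bounded_pos compact_imp_bounded imageI)
  have lim: "((\<lambda>a. f (a * \<xi>)) \<longlongrightarrow> f 0) (at_right 0)" for \<xi>
  proof -
    have "((\<lambda>a. f (a * \<xi>)) \<longlongrightarrow> f (0 * \<xi>)) (at_right 0)"
      by (intro isCont_tendsto_compose[OF DERIV_isCont[OF f'(1)]] tendsto_intros)
    then show ?thesis by simp
  qed
  \<comment> \<open>\<open>a < 1\<close> keeps \<open>a * \<xi>\<close> in \<open>[-M, M]\<close>, and \<open>a < m / B\<close> makes \<open>g' \<xi> / a\<close> exceed \<open>B\<close>.\<close>
  have "\<forall>\<^sub>F a in at_right 0. 0 < a \<and> a < min 1 (m / B)"
    using m B by (intro eventually_at_rightI[of 0 "min 1 (m / B)"]) auto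
  moreover note order_tendstoD(1)[OF lim[of \<xi>1] g1] order_tendstoD(2)[OF lim[of \<xi>2] g2]
  ultimately show ?thesis
  proof eventually_elim
    case (elim a)
    then have a: "0 < a" "a < 1" "a * B < m" using B by (auto simp: field_simps)
    have "continuous_on {\<xi>1..\<xi>2} (\<lambda>\<xi>. g \<xi> - f (a * \<xi>))"
      by (intro continuous_intros DERIV_continuous_on[OF has_field_derivative_at_within[OF g'(1)]]
          continuous_on_compose2[OF DERIV_continuous_on[OF f'(1)]]) auto
    then obtain \<xi> where \<xi>: "\<xi> \<in> {\<xi>1..\<xi>2}" "g \<xi> = f (a * \<xi>)"
      using IVT'[of "\<lambda>\<xi>. g \<xi> - f (a * \<xi>)" \<xi>1 0 \<xi>2] elim le by auto
    have "((\<lambda>x. g (x / a)) has_real_derivative g' \<xi> / a) (at (a * \<xi>))"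
      using DERIV_chain2[of g "g' \<xi>" "\<lambda>x. x / a" "a * \<xi>" "1 / a" UNIV]
        DERIV_cdivide[OF DERIV_ident, of a "a * \<xi>" UNIV] a g'(1)[of \<xi>]
      by simp
    moreover have "f' (a * \<xi>) < g' \<xi> / a"
    proof -
      have "\<bar>a * \<xi>\<bar> \<le> M"
        using \<xi>(1) a mult_left_le_one_le[of "\<bar>\<xi>\<bar>" a] by (auto simp: abs_mult M_def)
      then have "a * \<xi> \<in> {-M..M}" by (simp add: abs_le_iff)
      then have "f' (a * \<xi>) \<le> B" using B(2) abs_le_D1 by blast
      then have "a * f' (a * \<xi>) \<le> a * B" using a by simp
      also have "\<dots> < g' \<xi>" using a m(2)[OF \<xi>(1)] by simp
      finally show ?thesis using a by (simp add: field_simps)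
    qed
    ultimately have "saddle (planar_field (\<lambda>x. g (x / a)) f) (vector [a * \<xi>, f (a * \<xi>)])"
      using f'(1) \<xi>(2) a by (intro saddle_planar_field) auto
    then show ?case using \<xi>(1) by blast
  qed
qed


section \<open>The sliding flow\<close>

lemma sliding_fun_planar_field [simp]:
  "sliding_fun (planar_field gp f) (planar_field gm f) q l = l * gp (q$1) + (1 - l) * gm (q$1) - q$2"
  by (simp add: sliding_fun_def filippov_field_planar_field grad_hsplit inner_axis)

lemma convex_weight_iff:
  fixes a b y :: real assumes "a < b"
  shows "(\<exists>l\<in>{0..1}. l * b + (1 - l) * a = y) \<longleftrightarrow> y \<in> {a..b}"
proof
  assume "\<exists>l\<in>{0..1}. l * b + (1 - l) * a = y"
  then obtain l where l: "0 \<le> l" "l \<le> 1" "y - a = l * (b - a)" by (auto simp: algebra_simps)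
  moreover have "0 \<le> l * (b - a)" "l * (b - a) \<le> b - a"
    using l assms by (auto intro: mult_left_le_one_le)
  ultimately show "y \<in> {a..b}" by simp
next
  assume "y \<in> {a..b}"
  define l where "l = (y - a) / (b - a)"
  have "l * (b - a) = y - a" using assms by (simp add: l_def)
  then have "l * b + (1 - l) * a = y" by (simp add: algebra_simps)
  moreover have "l \<in> {0..1}" using \<open>y \<in> {a..b}\<close> assms by (simp add: l_def)
  ultimately show "\<exists>l\<in>{0..1}. l * b + (1 - l) * a = y" by blast
qed

lemma sliding_region_planar_field:
  assumes "gm 0 < gp 0"
  shows "sliding_region (planar_field gp f) (planar_field gm f) = {q. q$1 = 0 \<and> q$2 \<in> {gm 0..gp 0}}"
  unfolding sliding_region_def
  by (intro Collect_cong conj_cong)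
    (simp_all add: splitting_manifold_def hsplit_def convex_weight_iff[OF assms])

text \<open>
  Inserting the weight \<open>l\<close> that cancels the first component leaves the second one, \<open>f 0 - y\<close>, which
  both fields share.
\<close>
lemma sliding_solution_planar_field:
  assumes "gm 0 < gp 0"
  shows "sliding_solution (planar_field gp f) (planar_field gm f) I \<gamma> \<longleftrightarrow>
    (\<forall>t\<in>I. \<gamma> t $ 1 = 0 \<and> \<gamma> t $ 2 \<in> {gm 0..gp 0} \<and>
       (\<gamma> has_vector_derivative vector [0, f 0 - \<gamma> t $ 2]) (at t within I))"
proof -
  let ?F = "filippov_field (planar_field gp f) (planar_field gm f)"
  have field: "?F q l = vector [0, f 0 - q$2]" if "q$1 = 0" "l * gp 0 + (1 - l) * gm 0 = q$2" for q l
    using that by (simp add: filippov_field_planar_field vec_eq_iff forall_2)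
  have "(\<exists>l\<in>{0..1}. sliding_fun (planar_field gp f) (planar_field gm f) (\<gamma> t) l = 0 \<and>
          (\<gamma> has_vector_derivative ?F (\<gamma> t) l) (at t within I))
      \<longleftrightarrow> \<gamma> t $ 2 \<in> {gm 0..gp 0} \<and> (\<gamma> has_vector_derivative vector [0, f 0 - \<gamma> t $ 2]) (at t within I)"
    if "\<gamma> t $ 1 = 0" for t
    unfolding convex_weight_iff[OF assms, symmetric]
    using that field[of "\<gamma> t"] by (auto simp: Bex_def cong: conj_cong)
  then show ?thesis
    unfolding sliding_solution_def
    by (intro ball_cong conj_cong refl) (simp_all add: splitting_manifold_def hsplit_def)
qed

definition sliding_orbit :: "real \<Rightarrow> real \<Rightarrow> real \<Rightarrow> real^2" where
  "sliding_orbit c y t = vector [0, c + (y - c) * exp (- t)]"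

text \<open>
  With \<open>y\<close> the second component of \<open>\<gamma>\<close>, the integrating factor \<open>exp s\<close> makes \<open>(y - f 0) * exp s\<close> constant.
\<close>
lemma sliding_solution_unique:
  assumes gmp: "gm 0 < gp 0" and I: "convex I" "0 \<in> I"
    and sol: "sliding_solution (planar_field gp f) (planar_field gm f) I \<gamma>"
    and t: "t \<in> I"
  shows "\<gamma> t = sliding_orbit (f 0) (\<gamma> 0 $ 2) t"
proof -
  have \<gamma>: "\<gamma> s $ 1 = 0" "(\<gamma> has_vector_derivative vector [0, f 0 - \<gamma> s $ 2]) (at s within I)" if "s \<in> I" for s
    using sol that by (auto simp: sliding_solution_planar_field[where gm = gm and gp = gp, OF gmp])
  define z where "z s = (\<gamma> s $ 2 - f 0) * exp s" for s
  have "(z has_real_derivative 0) (at s within I)" if "s \<in> I" for s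
  proof -
    have "((\<lambda>s. \<gamma> s $ 2) has_real_derivative f 0 - \<gamma> s $ 2) (at s within I)"
      using bounded_linear.has_vector_derivative[OF bounded_linear_vec_nth \<gamma>(2)[OF that], of 2]
      by (simp add: has_real_derivative_iff_has_vector_derivative)
    then show ?thesis unfolding z_def
      by (auto intro!: derivative_eq_intros simp: algebra_simps)
  qed
  then have "z t = z 0"
    using has_field_derivative_zero_constant[OF I(1), of z] I(2) t by metis
  then have "\<gamma> t $ 2 - f 0 = (\<gamma> 0 $ 2 - f 0) * exp (- t)"
    by (simp add: z_def exp_minus field_simps)
  then show ?thesis
    using \<gamma>(1)[OF t] by (simp add: sliding_orbit_def vec_eq_iff forall_2)
qed

text \<open>
  The orbit stays in the sliding segment since it moves along the line segment from \<open>y\<close> to \<open>f 0\<close>.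
\<close>
lemma sliding_orbit_is_solution:
  assumes "gm 0 < f 0" "f 0 < gp 0" "y \<in> {gm 0..gp 0}"
  shows "sliding_solution (planar_field gp f) (planar_field gm f) {0..} (sliding_orbit (f 0) y)"
proof -
  have range: "c + (y - c) * exp (- t) \<in> {a..b}"
    if "a < c" "c < b" "y \<in> {a..b}" "0 \<le> t" for a b c t :: real
  proof -
    have e: "0 \<le> exp (- t)" "exp (- t) \<le> 1" using that by auto
    have "c + (y - c) * exp (- t) = (1 - exp (- t)) *\<^sub>R c + exp (- t) *\<^sub>R y" by (simp add: algebra_simps)
    also have "\<dots> \<in> {a..b}" using that e
      by (intro convexD_alt[OF convex_real_interval(5)]) auto
    finally show ?thesis .
  qed
  have "(sliding_orbit (f 0) y has_vector_derivative vector [0, f 0 - sliding_orbit (f 0) y t $ 2]) (at t within {0..})" for t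
  proof -
    have "sliding_orbit (f 0) y = (\<lambda>t. (f 0 + (y - f 0) * exp (- t)) *\<^sub>R axis 2 1)"
      by (auto simp: sliding_orbit_def vec_eq_iff forall_2 axis_def)
    moreover have "((\<lambda>t. (f 0 + (y - f 0) * exp (- t)) *\<^sub>R axis 2 1) has_vector_derivative
        (- (y - f 0) * exp (- t)) *\<^sub>R (axis 2 1 :: real^2)) (at t within {0..})"
      by (intro has_vector_derivative_scaleR[OF _ has_vector_derivative_const, THEN has_vector_derivative_eq_rhs])
         (auto intro!: derivative_eq_intros simp: algebra_simps)
    moreover have "(- (y - f 0) * exp (- t)) *\<^sub>R (axis 2 1 :: real^2) = vector [0, f 0 - sliding_orbit (f 0) y t $ 2]"
      by (auto simp: sliding_orbit_def vec_eq_iff forall_2 axis_def algebra_simps)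
    ultimately show ?thesis by simp
  qed
  moreover have "sliding_orbit (f 0) y t $ 1 = 0" "sliding_orbit (f 0) y t $ 2 \<in> {gm 0..gp 0}"
    if "0 \<le> t" for t
    using range[of "gm 0" "f 0" "gp 0" t] assms that by (simp_all add: sliding_orbit_def)
  moreover have "gm 0 < gp 0" using assms by simp
  ultimately show ?thesis
    by (simp add: sliding_solution_planar_field[of gm gp])
qed

lemma dist_sliding_solution:
  assumes gmp: "gm 0 < gp 0" and I: "convex I" "0 \<in> I"
    and sol: "sliding_solution (planar_field gp f) (planar_field gm f) I \<gamma>"
    and t: "t \<in> I"
  shows "dist (\<gamma> t) (vector [0, f 0]) = \<bar>\<gamma> 0 $ 2 - f 0\<bar> * exp (- t)"
proof -
  have "\<gamma> t - vector [0, f 0] = ((\<gamma> 0 $ 2 - f 0) * exp (- t)) *\<^sub>R axis 2 1"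
    by (subst sliding_solution_unique[of gm gp I f \<gamma> t, OF assms])
      (simp add: sliding_orbit_def vec_eq_iff forall_2 axis_def)
  then show ?thesis by (simp add: dist_norm norm_axis_1 abs_mult)
qed

lemma sliding_tends_to_pseudoequilibrium:
  assumes "gm 0 < f 0" "f 0 < gp 0"
    and q: "q \<in> sliding_region (planar_field gp f) (planar_field gm f)"
  shows "sliding_tends_to (planar_field gp f) (planar_field gm f) q (vector [0, f 0])"
proof -
  have gmp: "gm 0 < gp 0" using assms by simp
  have q': "q$1 = 0" "q$2 \<in> {gm 0..gp 0}"
    using q by (auto simp: sliding_region_planar_field[of gm gp, OF gmp])
  have "sliding_orbit (f 0) (q$2) 0 = q"
    using q' by (simp add: sliding_orbit_def vec_eq_iff forall_2)
  moreover have "(\<gamma> \<longlongrightarrow> vector [0, f 0]) at_top"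
    if "sliding_solution (planar_field gp f) (planar_field gm f) {0..} \<gamma>" for \<gamma>
  proof -
    have "((\<lambda>t. \<bar>\<gamma> 0 $ 2 - f 0\<bar> * exp (- t)) \<longlongrightarrow> 0) at_top"
      by (intro tendsto_mult_right_zero filterlim_compose[OF exp_at_bot] filterlim_uminus_at_bot_at_top)
    moreover have "\<forall>\<^sub>F t in at_top. \<bar>\<gamma> 0 $ 2 - f 0\<bar> * exp (- t) = dist (\<gamma> t) (vector [0, f 0])"
      using eventually_ge_at_top[of 0]
      by eventually_elim (rule dist_sliding_solution[of gm gp "{0..}" f \<gamma>, symmetric, OF gmp _ _ that], auto)
    ultimately have "((\<lambda>t. dist (\<gamma> t) (vector [0, f 0])) \<longlongrightarrow> 0) at_top"
      by (rule Lim_transform_eventually)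
    then show ?thesis by (subst tendsto_dist_iff)
  qed
  ultimately show ?thesis
    using sliding_orbit_is_solution[where f = f and gm = gm and gp = gp, OF assms(1,2) q'(2)]
    unfolding sliding_tends_to_def by blast
qed

lemma sliding_asymptotically_stable_pseudoequilibrium:
  assumes "gm 0 < f 0" "f 0 < gp 0"
  shows "sliding_asymptotically_stable (planar_field gp f) (planar_field gm f) (vector [0, f 0])"
  unfolding sliding_asymptotically_stable_def
proof (intro conjI allI impI)
  fix \<epsilon> :: real assume \<epsilon>: "0 < \<epsilon>"
  have gmp: "gm 0 < gp 0" using assms by simp
  have "dist (\<gamma> t) (vector [0, f 0]) < \<epsilon>"
    if sol: "sliding_solution (planar_field gp f) (planar_field gm f) {0..T} \<gamma>"
      and d: "dist (\<gamma> 0) (vector [0, f 0]) < \<epsilon>" and t: "t \<in> {0..T}" for \<gamma> T t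
  proof -
    have *: "dist (\<gamma> s) (vector [0, f 0]) = \<bar>\<gamma> 0 $ 2 - f 0\<bar> * exp (- s)" if "s \<in> {0..T}" for s
      using t that by (intro dist_sliding_solution[of gm gp "{0..T}" f \<gamma>, OF gmp _ _ sol]) auto
    have "\<bar>\<gamma> 0 $ 2 - f 0\<bar> * exp (- t) \<le> \<bar>\<gamma> 0 $ 2 - f 0\<bar> * exp (- 0)"
      using t by (intro mult_left_mono) auto
    then show ?thesis using *[of 0] *[of t] t d by simp
  qed
  then show "\<exists>\<delta>>0. \<forall>q\<in>sliding_region (planar_field gp f) (planar_field gm f).
      dist q (vector [0, f 0]) < \<delta> \<longrightarrow>
      (\<forall>\<gamma> T. sliding_solution (planar_field gp f) (planar_field gm f) {0..T} \<gamma> \<and> \<gamma> 0 = q \<longrightarrow>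
        (\<forall>t\<in>{0..T}. dist (\<gamma> t) (vector [0, f 0]) < \<epsilon>))"
    using \<epsilon> by blast
next
  show "\<exists>\<delta>>0. \<forall>q\<in>sliding_region (planar_field gp f) (planar_field gm f).
      dist q (vector [0, f 0]) < \<delta> \<longrightarrow>
      sliding_tends_to (planar_field gp f) (planar_field gm f) q (vector [0, f 0])"
    using sliding_tends_to_pseudoequilibrium[where f = f and gm = gm and gp = gp, OF assms] by (intro exI[of _ 1]) auto
qed

lemma local_stable_manifold_open_sliding_segment:
  assumes "gm 0 < f 0" "f 0 < gp 0"
  shows "local_stable_manifold (planar_field gp f) (planar_field gm f) (vector [0, f 0])
    {q. q$1 = 0 \<and> q$2 \<in> {gm 0<..<gp 0}}" (is "local_stable_manifold ?fp ?fm ?p ?W")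
  unfolding local_stable_manifold_def
proof (intro conjI ballI)
  have gmp: "gm 0 < gp 0" using assms by simp
  show sub: "?W \<subseteq> sliding_region ?fp ?fm"
    by (auto simp: sliding_region_planar_field[of gm gp, OF gmp])
  have "open {q :: real^2. gm 0 < q$2 \<and> q$2 < gp 0}"
    by (intro open_Collect_conj open_Collect_less continuous_intros)
  moreover have "?W = splitting_manifold \<inter> {q. gm 0 < q$2 \<and> q$2 < gp 0}"
    by (auto simp: splitting_manifold_def hsplit_def)
  ultimately show "openin (top_of_set splitting_manifold) ?W" by (auto intro: openin_open_Int)
  show "is_interval ?W"
    unfolding is_interval_cart forall_2 by force
  show "?p \<in> ?W" using assms by simp
  show "sliding_tends_to ?fp ?fm q ?p" if "q \<in> ?W" for q
    using sliding_tends_to_pseudoequilibrium[where f = f and gm = gm and gp = gp, OF assms] sub that by blast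
qed


section \<open>Trajectories leaving the pseudoequilibrium\<close>

lemma planar_field_departs_right:
  assumes "smooth_on {0..} u" "smooth_on UNIV f" "f 0 < u 0"
  shows "\<exists>T \<gamma>. unique_emanating (planar_field u f) {q. hsplit q > 0} (vector [0, f 0]) T \<gamma>"
proof -
  let ?n = "axis 1 1 :: real^2" and ?p = "vector [0, f 0] :: real^2"
  have n: "?n \<bullet> (q - ?p) = q$1" for q by (simp add: inner_axis' inner_commute)
  have "\<exists>L. L-lipschitz_on (cball ?p R \<inter> {q. 0 \<le> ?n \<bullet> (q - ?p)}) (planar_field u f)" for R
    using planar_field_lipschitz[of "{0..}" u f ?p R] assms smooth_on_subset[of UNIV f] by (simp add: n)
  from transversal_departure[OF this] show ?thesis
    using assms(3) by (simp add: n hsplit_def inner_axis')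
qed

lemma planar_field_departs_left:
  assumes "smooth_on {..0} u" "smooth_on UNIV f" "u 0 < f 0"
  shows "\<exists>T \<gamma>. unique_emanating (planar_field u f) {q. hsplit q < 0} (vector [0, f 0]) T \<gamma>"
proof -
  let ?n = "- axis 1 1 :: real^2" and ?p = "vector [0, f 0] :: real^2"
  have n: "?n \<bullet> (q - ?p) = - q$1" for q by (simp add: inner_axis' inner_commute)
  have "\<exists>L. L-lipschitz_on (cball ?p R \<inter> {q. 0 \<le> ?n \<bullet> (q - ?p)}) (planar_field u f)" for R
    unfolding n using planar_field_lipschitz[of "{..0}" u f ?p R] assms smooth_on_subset[of UNIV f] by simp
  from transversal_departure[OF this] show ?thesis
    unfolding n using assms(3) by (simp add: hsplit_def inner_axis')
qed


section \<open>The saddles and the pseudoequilibrium\<close>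

theorem theorem3p1:
  fixes f g gp gm g0 :: "real \<Rightarrow> real"
  assumes "smooth_on UNIV f"
    and "smooth_on UNIV g"
    and "\<And>\<xi>. deriv g \<xi> > 0"
    and "smooth_on {0..} gp"
    and "smooth_on {..0} gm"
    and "\<And>x. x > 0 \<Longrightarrow> g0 x = gp x"
    and "\<And>x. x < 0 \<Longrightarrow> g0 x = gm x"
    and "\<And>x. x \<noteq> 0 \<Longrightarrow> ((\<lambda>a. g (x / a)) \<longlongrightarrow> g0 x) (at_right 0)"
    and "gm 0 < f 0"
    and "f 0 < gp 0"
  shows "(\<exists>xa ya :: real \<Rightarrow> real.
      (\<forall>\<^sub>F a in at_right 0. saddle (planar_field (\<lambda>x. g (x / a)) f) (vector [xa a, ya a])) \<and>
      (xa \<longlongrightarrow> 0) (at_right 0)) \<and>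
    (\<exists>p. pseudoequilibrium (planar_field gp f) (planar_field gm f) p \<and>
      p \<in> sliding_region (planar_field gp f) (planar_field gm f) \<and>
      repelling_sliding (planar_field gp f) (planar_field gm f) \<and>
      sliding_asymptotically_stable (planar_field gp f) (planar_field gm f) p \<and>
      (\<exists>W. local_stable_manifold (planar_field gp f) (planar_field gm f) p W) \<and>
      (\<exists>W. local_unstable_manifold (planar_field gp f) (planar_field gm f) p W))"
proof
  \<comment> \<open>At a small \<open>x2 > 0\<close> still \<open>f 0 < gp x2\<close>, and \<open>gp x2\<close> is a limit of values \<open>g (x2 / a)\<close>; so \<open>g\<close>
    exceeds \<open>f 0\<close> at a positive point. On the left, \<open>g\<close> is below \<open>f 0\<close> at a negative point.\<close>
  have "(gp \<longlongrightarrow> gp 0) (at_right 0)"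
    using smooth_on_imp_continuous_on[OF assms(4)] unfolding continuous_on_def
    by (auto intro: tendsto_within_subset)
  from eventually_happens'[OF trivial_limit_at_right_real eventually_conj[OF eventually_at_right_less order_tendstoD(1)[OF this assms(10)]]]
  obtain x2 where x2: "0 < x2" "f 0 < gp x2" by auto
  have "\<forall>\<^sub>F a in at_right 0. f 0 < g (x2 / a)"
    using order_tendstoD(1)[OF assms(8), of x2 "f 0"] x2 assms(6) by simp
  from eventually_happens'[OF trivial_limit_at_right_real eventually_conj[OF eventually_at_right_less this]]
  obtain \<xi>2 where \<xi>2: "0 < \<xi>2" "f 0 < g \<xi>2" using x2(1) by (metis divide_pos_pos)
  have "(gm \<longlongrightarrow> gm 0) (at_left 0)"
    using smooth_on_imp_continuous_on[OF assms(5)] unfolding continuous_on_def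
    by (auto intro: tendsto_within_subset)
  moreover have "\<forall>\<^sub>F x in at_left 0. x < (0::real)" by (simp add: eventually_at_filter)
  ultimately have "\<forall>\<^sub>F x in at_left 0. x < 0 \<and> gm x < f 0"
    by (auto intro: eventually_conj order_tendstoD(2)[OF _ assms(9)])
  from eventually_happens'[OF trivial_limit_at_left_real this]
  obtain x1 where x1: "x1 < 0" "gm x1 < f 0" by auto
  have "\<forall>\<^sub>F a in at_right 0. g (x1 / a) < f 0"
    using order_tendstoD(2)[OF assms(8), of x1 "f 0"] x1 assms(7) by simp
  from eventually_happens'[OF trivial_limit_at_right_real eventually_conj[OF eventually_at_right_less this]]
  obtain \<xi>1 where \<xi>1: "\<xi>1 < 0" "g \<xi>1 < f 0" using x1(1) by (metis divide_neg_pos)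
  let ?P = "\<lambda>a \<xi>. \<xi> \<in> {\<xi>1..\<xi>2} \<and> saddle (planar_field (\<lambda>x. g (x / a)) f) (vector [a * \<xi>, f (a * \<xi>)])"
  define \<xi> where "\<xi> a = (SOME \<xi>. ?P a \<xi>)" for a
  have ev: "\<forall>\<^sub>F a in at_right 0. ?P a (\<xi> a)"
  proof (rule eventually_mono)
    show "\<forall>\<^sub>F a in at_right 0. \<exists>\<xi>. ?P a \<xi>"
      using saddle_family[OF assms(1-3) _ \<xi>1(2) \<xi>2(2)] \<xi>1(1) \<xi>2(1) by (simp add: Bex_def)
    show "?P a (\<xi> a)" if "\<exists>\<xi>. ?P a \<xi>" for a
      unfolding \<xi>_def using that by (rule someI_ex)
  qed
  have "((\<lambda>a. a * \<xi> a) \<longlongrightarrow> 0) (at_right 0)"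
  proof (rule tendsto_sandwich)
    show "\<forall>\<^sub>F a in at_right 0. a * \<xi>1 \<le> a * \<xi> a" "\<forall>\<^sub>F a in at_right 0. a * \<xi> a \<le> a * \<xi>2"
      using ev eventually_at_right_less[of 0] by (eventually_elim, simp)+
    show "((\<lambda>a. a * \<xi>1) \<longlongrightarrow> 0) (at_right 0)" "((\<lambda>a. a * \<xi>2) \<longlongrightarrow> 0) (at_right 0)"
      by (intro tendsto_mult_left_zero tendsto_ident_at)+
  qed
  with ev show "\<exists>xa ya :: real \<Rightarrow> real.
      (\<forall>\<^sub>F a in at_right 0. saddle (planar_field (\<lambda>x. g (x / a)) f) (vector [xa a, ya a])) \<and>
      (xa \<longlongrightarrow> 0) (at_right 0)"
    by (intro exI[of _ "\<lambda>a. a * \<xi> a"] exI[of _ "\<lambda>a. f (a * \<xi> a)"]) (auto elim: eventually_mono)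
next
  let ?fp = "planar_field gp f" and ?fm = "planar_field gm f" and ?p = "vector [0, f 0] :: real^2"
  have gmp: "gm 0 < gp 0" using assms(9,10) by simp
  obtain l where l: "l \<in> {0..1}" "l * gp 0 + (1 - l) * gm 0 = f 0"
    using convex_weight_iff[of "gm 0" "gp 0" "f 0"] assms(9,10) by auto
  then have "filippov_field ?fp ?fm ?p l = 0"
    by (simp add: filippov_field_planar_field vec_eq_iff forall_2)
  moreover have "?fp ?p \<noteq> 0" "?fm ?p \<noteq> 0"
    using assms(9,10) by (auto simp: vec_eq_iff forall_2)
  ultimately have "pseudoequilibrium ?fp ?fm ?p"
    using l(1) by (auto simp: pseudoequilibrium_def splitting_manifold_def hsplit_def)
  moreover have "?p \<in> sliding_region ?fp ?fm"
    using assms(9,10) by (simp add: sliding_region_planar_field[of gm gp, OF gmp])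
  moreover have "repelling_sliding ?fp ?fm"
    unfolding repelling_sliding_def
  proof (intro ballI impI)
    fix q l assume "q \<in> sliding_region ?fp ?fm"
    then have "q$1 = 0" by (simp add: sliding_region_planar_field[of gm gp, OF gmp])
    then have "(sliding_fun ?fp ?fm q has_real_derivative gp 0 - gm 0) (at l)"
      unfolding sliding_fun_planar_field[abs_def] by (auto intro!: derivative_eq_intros)
    then show "0 < deriv (sliding_fun ?fp ?fm q) l"
      using gmp by (simp add: DERIV_imp_deriv)
  qed
  moreover have "\<exists>W. local_unstable_manifold ?fp ?fm ?p W"
    using planar_field_departs_right[OF assms(4,1,10)] planar_field_departs_left[OF assms(5,1,9)]
    unfolding local_unstable_manifold_def by blast
  ultimately show "\<exists>p. pseudoequilibrium ?fp ?fm p \<and> p \<in> sliding_region ?fp ?fm \<and>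
      repelling_sliding ?fp ?fm \<and> sliding_asymptotically_stable ?fp ?fm p \<and>
      (\<exists>W. local_stable_manifold ?fp ?fm p W) \<and> (\<exists>W. local_unstable_manifold ?fp ?fm p W)"
    using sliding_asymptotically_stable_pseudoequilibrium[where f = f and gm = gm and gp = gp, OF assms(9,10)]
      local_stable_manifold_open_sliding_segment[where f = f and gm = gm and gp = gp, OF assms(9,10)] by blast
qed

end
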